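(* Let $V$ be an $n$-dimensional complex vector space with basis $e_1,\ldots,e_n$ and dual basis $e_1^*,\ldots,e_n^*$. Let $a_{ij}=e_i\otimes e_j-e_j\otimes e_i\in\Lambda_2(V)$ and $b_{ij}=e_i^*\otimes e_j^*+e_j^*\otimes e_i^*\in S_2(V^* )$, and let $A=(a_{ij})_{1\le i,j\le n}$, $B=(b_{ij})_{1\le i,j\le n}\in\operatorname{Mat}_{n,n}(\Lambda(\Lambda_2(V)\oplus S_2(V^* )))$. Then $(AB)^{n-1}A=0$.
   Context: $\Lambda(\Lambda_2(V)\oplus S_2(V^* ))$ is the exterior algebra on $\Lambda_2(V)\oplus S_2(V^* )$; the $a_{ij}$ and $b_{ij}$ are elements of degree one in it (so they pairwise anticommute), with $a_{ji}=-a_{ij}$ and $b_{ji}=b_{ij}$. Matrix products are taken with entries multiplied in the order written; $(AB)^0$ is the identity matrix. *)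

theory Defs
  imports Complex_Main "HOL-Library.Product_Lexorder"
begin

text \<open>Generators of the exterior algebra \<Lambda>(\<Lambda>_2(V) \<oplus> S_2(V^*)):
  GA i j stands for a_ij (used with i < j), GB i j stands for b_ij (used with i \<le> j).
  These form a basis of \<Lambda>_2(V) \<oplus> S_2(V^*).\<close>
datatype gen = GA nat nat | GB nat nat

fun gkey :: "gen \<Rightarrow> nat \<times> nat \<times> nat" where
  "gkey (GA i j) = (0, i, j)"
| "gkey (GB i j) = (1, i, j)"

text \<open>An element of the exterior algebra: coefficient of each monomial e_S (S a finite set of
  generators, taken in increasing gkey order).\<close>
type_synonym ext = "gen set \<Rightarrow> complex"

definition ext_zero :: ext where "ext_zero = (\<lambda>S. 0)"
definition ext_one :: ext where "ext_one = (\<lambda>S. if S = {} then 1 else 0)"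
definition ext_gen :: "gen \<Rightarrow> ext" where "ext_gen g = (\<lambda>S. if S = {g} then 1 else 0)"
definition ext_neg :: "ext \<Rightarrow> ext" where "ext_neg x = (\<lambda>S. - x S)"

definition inv_count :: "gen set \<Rightarrow> gen set \<Rightarrow> nat" where
  "inv_count T U = card {(t, u). t \<in> T \<and> u \<in> U \<and> gkey u < gkey t}"

text \<open>Wedge product: e_T \<and> e_U = (-1)^inv(T,U) e_(T \<union> U) for disjoint T, U, and 0 otherwise.\<close>
definition ext_mult :: "ext \<Rightarrow> ext \<Rightarrow> ext" where
  "ext_mult x y = (\<lambda>S. if finite S
     then (\<Sum>T\<in>Pow S. (-1) ^ inv_count T (S - T) * x T * y (S - T)) else 0)"

text \<open>n x n matrices over the exterior algebra, indices 1..n.\<close>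
type_synonym emat = "nat \<Rightarrow> nat \<Rightarrow> ext"

definition mat_mult :: "nat \<Rightarrow> emat \<Rightarrow> emat \<Rightarrow> emat" where
  "mat_mult n M N = (\<lambda>i k S. \<Sum>j\<in>{1..n}. ext_mult (M i j) (N j k) S)"

definition mat_id :: emat where
  "mat_id = (\<lambda>i k. if i = k then ext_one else ext_zero)"

fun mat_pow :: "nat \<Rightarrow> emat \<Rightarrow> nat \<Rightarrow> emat" where
  "mat_pow n M 0 = mat_id"
| "mat_pow n M (Suc m) = mat_mult n (mat_pow n M m) M"

definition a_entry :: "nat \<Rightarrow> nat \<Rightarrow> ext" where
  "a_entry i j = (if i < j then ext_gen (GA i j)
                  else if j < i then ext_neg (ext_gen (GA j i)) else ext_zero)"

definition b_entry :: "nat \<Rightarrow> nat \<Rightarrow> ext" where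
  "b_entry i j = ext_gen (GB (min i j) (max i j))"

end

theory Submission
  imports Defs "Jordan_Normal_Form.Determinant" "HOL-Computational_Algebra.Formal_Power_Series"
begin

text \<open>The entries of \<open>C = AB\<close> are even, so \<open>C\<close> is a matrix over a commutative ring.
  Since odd elements anticommute, \<open>(AB)\<^sup>T = BA\<close>, while cyclicity of the trace holds up to a sign
  for odd factors; hence \<open>tr (C^k) = - tr (C^k)\<close>, and all these traces vanish for \<open>k > 0\<close>.
  Consequently \<open>det (1 - tC) = 1\<close>, so that \<open>adj (1 - tC) = (1 - tC)^-1\<close>, and comparing coefficients of
  \<open>t^(n-1)\<close> gives \<open>adj (- C) = C^(n-1)\<close>.

  It remains to show \<open>adj (- AB) A = 0\<close>. For even \<open>x_1, \<dots>, x_n\<close> the odd elements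
  \<open>y_i = \<Sum>_j a_ij x_j\<close> satisfy \<open>\<Sum>_i x_i y_i = 0\<close> by skew-symmetry of \<open>A\<close>, which forces
  \<open>y_1 \<cdots> y_n = 0\<close>. Taking \<open>x_j = \<Sum>_l b'_jl w_l\<close> with fresh odd generators \<open>w_l\<close> shows
  \<open>det (A B') = 0\<close> for every matrix \<open>B'\<close> of odd elements. Replacing column \<open>k\<close> of \<open>B\<close> by the
  vector with a single fresh generator in position \<open>m\<close> and expanding along that column, one
  obtains the \<open>(k, m)\<close> entry of \<open>adj (- AB) A\<close>.\<close>

section \<open>The exterior algebra as a ring\<close>

text \<open>The type of all coefficient functions contains elements supported on infinite sets, for which
  the unit law of \<^const>\<open>ext_mult\<close> fails; they have to be cut out.\<close>
typedef grassmann = "{x :: ext. \<forall>S. infinite S \<longrightarrow> x S = 0}"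
  morphisms gcoeff Abs_grassmann
  by (rule exI[of _ ext_zero]) (simp add: ext_zero_def)

setup_lifting type_definition_grassmann

lemma gcoeff_infinite: "infinite S \<Longrightarrow> gcoeff x S = 0"
  using gcoeff[of x] by simp

lemma grassmann_eqI: "(\<And>S. finite S \<Longrightarrow> gcoeff x S = gcoeff y S) \<Longrightarrow> x = y"
  by (metis gcoeff_infinite gcoeff_inject ext)

section \<open>Signs of products of monomials\<close>

abbreviation gsgn :: "gen set \<Rightarrow> gen set \<Rightarrow> complex" where
  "gsgn T U \<equiv> (-1) ^ inv_count T U"

lemma inv_count_finite:
  "finite T \<Longrightarrow> finite U \<Longrightarrow> finite {(t, u). t \<in> T \<and> u \<in> U \<and> gkey u < gkey t}"
  by (rule finite_subset[of _ "T \<times> U"]) auto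

lemma inv_count_Un_left:
  assumes "finite T" "finite U" "finite W" "T \<inter> U = {}"
  shows "inv_count (T \<union> U) W = inv_count T W + inv_count U W"
proof -
  have "{(t, u). t \<in> T \<union> U \<and> u \<in> W \<and> gkey u < gkey t} =
    {(t, u). t \<in> T \<and> u \<in> W \<and> gkey u < gkey t} \<union> {(t, u). t \<in> U \<and> u \<in> W \<and> gkey u < gkey t}"
    by auto
  then show ?thesis
    using assms unfolding inv_count_def by (simp add: card_Un_disjoint inv_count_finite disjoint_iff)
qed

lemma inv_count_Un_right:
  assumes "finite T" "finite U" "finite W" "U \<inter> W = {}"
  shows "inv_count T (U \<union> W) = inv_count T U + inv_count T W"
proof -
  have "{(t, u). t \<in> T \<and> u \<in> U \<union> W \<and> gkey u < gkey t} =
    {(t, u). t \<in> T \<and> u \<in> U \<and> gkey u < gkey t} \<union> {(t, u). t \<in> T \<and> u \<in> W \<and> gkey u < gkey t}"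
    by auto
  then show ?thesis
    using assms unfolding inv_count_def by (simp add: card_Un_disjoint inv_count_finite disjoint_iff)
qed

lemma inv_count_empty [simp]: "inv_count {} U = 0" "inv_count T {} = 0"
  by (simp_all add: inv_count_def)

lemma gkey_inject: "gkey x = gkey y \<Longrightarrow> x = y"
  by (cases x; cases y) auto

text \<open>Keys are distinct, so each pair in \<open>T \<times> U\<close> is an inversion in
  exactly one of the two orders. All commutation signs come from this count.\<close>

lemma inv_count_swap:
  assumes "finite T" "finite U" "T \<inter> U = {}"
  shows "inv_count T U + inv_count U T = card T * card U"
proof -
  let ?P = "{(t, u). t \<in> T \<and> u \<in> U \<and> gkey u < gkey t}"
  let ?Q = "{(u, t). u \<in> U \<and> t \<in> T \<and> gkey t < gkey u}"
  have "T \<times> U = ?P \<union> prod.swap ` ?Q"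
    using assms(3) gkey_inject by (force simp: image_iff not_less_iff_gr_or_eq)
  moreover have "?P \<inter> prod.swap ` ?Q = {}" by auto
  moreover have "finite ?P" "finite ?Q" using assms by (auto intro: inv_count_finite)
  ultimately have "card (T \<times> U) = card ?P + card (prod.swap ` ?Q)"
    by (metis (no_types, lifting) card_Un_disjoint finite_imageI)
  also have "card (prod.swap ` ?Q) = card ?Q"
    by (rule card_image) simp
  finally show ?thesis unfolding inv_count_def card_cartesian_product by simp
qed

instantiation grassmann :: ring_1
begin

lift_definition zero_grassmann :: grassmann is ext_zero by (simp add: ext_zero_def)
lift_definition one_grassmann :: grassmann is ext_one by (auto simp: ext_one_def)
lift_definition plus_grassmann :: "grassmann \<Rightarrow> grassmann \<Rightarrow> grassmann" is "\<lambda>x y S. x S + y S" by simp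
lift_definition minus_grassmann :: "grassmann \<Rightarrow> grassmann \<Rightarrow> grassmann" is "\<lambda>x y S. x S - y S" by simp
lift_definition uminus_grassmann :: "grassmann \<Rightarrow> grassmann" is ext_neg by (simp add: ext_neg_def)
lift_definition times_grassmann :: "grassmann \<Rightarrow> grassmann \<Rightarrow> grassmann" is ext_mult
  by (simp add: ext_mult_def)

lemma gcoeff_times:
  "finite S \<Longrightarrow> gcoeff (x * y) S = (\<Sum>T\<in>Pow S. gsgn T (S - T) * gcoeff x T * gcoeff y (S - T))"
  by (simp add: times_grassmann.rep_eq ext_mult_def)

text \<open>Both sides expand to a sum over the ordered partitions of \<open>S\<close> into three
  blocks; the signs agree because \<open>inv_count\<close> is additive in each argument.\<close>

lemma grassmann_assoc:
  fixes x y z :: grassmann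
  shows "x * y * z = x * (y * z)"
proof (rule grassmann_eqI)
  fix S :: "gen set" assume S: "finite S"
  have fin: "finite T" if "T \<subseteq> S" for T using S that finite_subset by blast
  have "gcoeff (x * y * z) S = (\<Sum>T\<in>Pow S. \<Sum>U\<in>Pow T.
      gsgn T (S - T) * gsgn U (T - U) * gcoeff x U * gcoeff y (T - U) * gcoeff z (S - T))"
    using S fin by (simp add: gcoeff_times sum_distrib_left sum_distrib_right mult_ac)
  also have "\<dots> = (\<Sum>(T, U)\<in>Sigma (Pow S) Pow.
      gsgn T (S - T) * gsgn U (T - U) * gcoeff x U * gcoeff y (T - U) * gcoeff z (S - T))"
    using S fin by (intro sum.Sigma) auto
  also have "\<dots> = (\<Sum>(U, V)\<in>Sigma (Pow S) (\<lambda>U. Pow (S - U)).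
      gsgn U (S - U) * gsgn V (S - U - V) * gcoeff x U * gcoeff y V * gcoeff z (S - U - V))"
  \<comment> \<open>A chain U \<subseteq> T \<subseteq> S is re-encoded by its first two blocks, U
    and V = T - U.\<close>
  proof (rule sum.reindex_bij_witness[of _ "\<lambda>(U, V). (U \<union> V, U)" "\<lambda>(T, U). (U, T - U)"], goal_cases)
    case (5 p)
    obtain T U where p: "p = (T, U)" by force
    with 5 have TU: "T \<subseteq> S" "U \<subseteq> T" by auto
    let ?V = "T - U" let ?W = "S - T"
    have eqs: "S - U = ?V \<union> ?W" "T = U \<union> ?V" "S - U - ?V = ?W" using TU by auto
    have f: "finite U" "finite ?V" "finite ?W" using TU fin by auto
    have "inv_count (U \<union> ?V) ?W = inv_count U ?W + inv_count ?V ?W"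
      using f by (intro inv_count_Un_left) auto
    moreover have "inv_count U (?V \<union> ?W) = inv_count U ?V + inv_count U ?W"
      using f by (intro inv_count_Un_right) auto
    ultimately have "gsgn T ?W * gsgn U ?V = gsgn U (S - U) * gsgn ?V ?W"
      using eqs by (metis (no_types, lifting) ab_semigroup_add_class.add_ac(1) add.commute power_add)
    then show ?case using eqs(3) by (simp add: p)
  qed auto
  also have "\<dots> = (\<Sum>U\<in>Pow S. \<Sum>V\<in>Pow (S - U).
      gsgn U (S - U) * gsgn V (S - U - V) * gcoeff x U * gcoeff y V * gcoeff z (S - U - V))"
    using S fin by (intro sum.Sigma[symmetric]) auto
  also have "\<dots> = gcoeff (x * (y * z)) S"
    using S fin by (simp add: gcoeff_times sum_distrib_left sum_distrib_right mult_ac)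
  finally show "gcoeff (x * y * z) S = gcoeff (x * (y * z)) S" .
qed

instance
proof
  fix x y z :: grassmann
  show "x * y * z = x * (y * z)" by (rule grassmann_assoc)
  show "x + y + z = x + (y + z)" by transfer (simp add: add.assoc)
  show "x + y = y + x" by transfer (simp add: add.commute)
  show "0 + x = x" by transfer (simp add: ext_zero_def)
  show "- x + x = 0" by transfer (simp add: ext_zero_def ext_neg_def)
  show "x - y = x + - y" by transfer (simp add: ext_neg_def)
  show "(0 :: grassmann) \<noteq> 1" by transfer (auto simp: ext_zero_def ext_one_def fun_eq_iff)
  show "(x + y) * z = x * z + y * z"
    by transfer (auto simp: ext_mult_def fun_eq_iff sum.distrib algebra_simps)
  show "x * (y + z) = x * y + x * z"
    by transfer (auto simp: ext_mult_def fun_eq_iff sum.distrib algebra_simps)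
  show "1 * x = x"
  proof (rule grassmann_eqI)
    fix S :: "gen set" assume S: "finite S"
    have "gcoeff (1 * x) S = (\<Sum>T\<in>Pow S. if T = {} then gcoeff x S else 0)"
      unfolding gcoeff_times[OF S] by (rule sum.cong) (auto simp: one_grassmann.rep_eq ext_one_def)
    then show "gcoeff (1 * x) S = gcoeff x S" using S by simp
  qed
  show "x * 1 = x"
  proof (rule grassmann_eqI)
    fix S :: "gen set" assume S: "finite S"
    have "gcoeff (x * 1) S = (\<Sum>T\<in>Pow S. if T = S then gcoeff x S else 0)"
      unfolding gcoeff_times[OF S] by (rule sum.cong) (auto simp: one_grassmann.rep_eq ext_one_def)
    then show "gcoeff (x * 1) S = gcoeff x S" using S by simp
  qed
qed

end

lemma gcoeff_simps [simp]:
  "gcoeff 0 S = 0" "gcoeff (x + y) S = gcoeff x S + gcoeff y S"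
  "gcoeff (x - y) S = gcoeff x S - gcoeff y S" "gcoeff (- x) S = - gcoeff x S"
  by (simp_all add: zero_grassmann.rep_eq ext_zero_def plus_grassmann.rep_eq
      minus_grassmann.rep_eq uminus_grassmann.rep_eq ext_neg_def)

lemma gcoeff_sum [simp]: "gcoeff (sum f I) S = (\<Sum>i\<in>I. gcoeff (f i) S)"
  by (induction I rule: infinite_finite_induct) auto

lemma gcoeff_1: "gcoeff 1 S = (if S = {} then 1 else 0)"
  by (simp add: one_grassmann.rep_eq ext_one_def)

text \<open>Coefficients are complex numbers. This turns x = - x into x = 0 and later allows
  integration of formal power series.\<close>

lemma grassmann_torsion_free:
  fixes x :: grassmann
  assumes "of_nat m * x = 0" "m > 0"
  shows "x = 0"
proof (rule grassmann_eqI)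
  fix S
  have "gcoeff (of_nat m * x) S = of_nat m * gcoeff x S"
    by (induction m) (auto simp: algebra_simps)
  with assms show "gcoeff x S = gcoeff 0 S" by simp
qed

lift_definition ggen :: "gen \<Rightarrow> grassmann" is ext_gen by (auto simp: ext_gen_def)

lemma gcoeff_ggen: "gcoeff (ggen g) S = (if S = {g} then 1 else 0)"
  by (simp add: ggen.rep_eq ext_gen_def)

section \<open>Parity and graded commutativity\<close>

definition geven :: "grassmann \<Rightarrow> bool" where
  "geven x \<longleftrightarrow> (\<forall>S. gcoeff x S \<noteq> 0 \<longrightarrow> even (card S))"
definition godd :: "grassmann \<Rightarrow> bool" where
  "godd x \<longleftrightarrow> (\<forall>S. gcoeff x S \<noteq> 0 \<longrightarrow> odd (card S))"

lemma gcoeff_times_nonzeroE: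
  assumes "gcoeff (x * y) S \<noteq> 0"
  obtains T U where "finite T" "finite U" "T \<inter> U = {}" "S = T \<union> U" "gcoeff x T \<noteq> 0" "gcoeff y U \<noteq> 0"
proof -
  have S: "finite S" using assms gcoeff_infinite by blast
  then have "\<exists>T\<in>Pow S. gsgn T (S - T) * gcoeff x T * gcoeff y (S - T) \<noteq> 0"
    using assms by (metis (no_types, lifting) gcoeff_times sum.neutral)
  then obtain T where "T \<subseteq> S" "gcoeff x T \<noteq> 0" "gcoeff y (S - T) \<noteq> 0" by auto
  then show thesis using S by (intro that[of T "S - T"]) (auto intro: finite_subset)
qed

lemma geven_godd_intros [intro, simp]:
  "geven 0" "godd 0" "geven 1" "godd (ggen g)"
  "geven x \<Longrightarrow> geven (- x)" "godd x \<Longrightarrow> godd (- x)"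
  unfolding geven_def godd_def by (auto simp: gcoeff_1 gcoeff_ggen split: if_splits)

lemma geven_add [intro, simp]: "geven x \<Longrightarrow> geven y \<Longrightarrow> geven (x + y)"
  unfolding geven_def by (metis add.right_neutral add_0 gcoeff_simps(2))
lemma godd_add [intro, simp]: "godd x \<Longrightarrow> godd y \<Longrightarrow> godd (x + y)"
  unfolding godd_def by (metis add.right_neutral add_0 gcoeff_simps(2))
lemma geven_diff [intro, simp]: "geven x \<Longrightarrow> geven y \<Longrightarrow> geven (x - y)"
  using geven_add[of x "-y"] by simp

lemma geven_sum [intro, simp]: "(\<And>i. i \<in> I \<Longrightarrow> geven (f i)) \<Longrightarrow> geven (sum f I)"
  by (induction I rule: infinite_finite_induct) auto
lemma godd_sum [intro, simp]: "(\<And>i. i \<in> I \<Longrightarrow> godd (f i)) \<Longrightarrow> godd (sum f I)"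
  by (induction I rule: infinite_finite_induct) auto

lemma geven_mult [intro, simp]:
  "geven x \<Longrightarrow> geven y \<Longrightarrow> geven (x * y)" "godd x \<Longrightarrow> godd y \<Longrightarrow> geven (x * y)"
  unfolding geven_def godd_def by (auto elim!: gcoeff_times_nonzeroE simp: card_Un_disjoint)
lemma godd_mult [intro, simp]:
  "geven x \<Longrightarrow> godd y \<Longrightarrow> godd (x * y)" "godd x \<Longrightarrow> geven y \<Longrightarrow> godd (x * y)"
  unfolding geven_def godd_def by (auto elim!: gcoeff_times_nonzeroE simp: card_Un_disjoint)

lemma gcoeff_times_swap:
  assumes S: "finite S"
  shows "gcoeff (y * x) S = (\<Sum>T\<in>Pow S. gsgn (S - T) T * gcoeff y (S - T) * gcoeff x T)"
  unfolding gcoeff_times[OF S]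
  by (rule sum.reindex_bij_witness[of _ "\<lambda>T. S - T" "\<lambda>T. S - T"]) (auto simp: double_diff)

text \<open>Exchanging the monomials on T and U costs the sign (-1)^(|T||U|), which is 1 when |T| is
  even.\<close>

lemma geven_commute:
  assumes "geven x" shows "x * y = y * x"
proof (rule grassmann_eqI)
  fix S :: "gen set" assume S: "finite S"
  show "gcoeff (x * y) S = gcoeff (y * x) S"
    unfolding gcoeff_times[OF S, of x y] gcoeff_times_swap[OF S, of y x]
  proof (rule sum.cong[OF refl])
    fix T assume T: "T \<in> Pow S"
    show "gsgn T (S - T) * gcoeff x T * gcoeff y (S - T) = gsgn (S - T) T * gcoeff y (S - T) * gcoeff x T"
    proof (cases "gcoeff x T = 0")
      case False
      then have "even (card T)" using assms by (auto simp: geven_def)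
      moreover have "inv_count T (S - T) + inv_count (S - T) T = card T * card (S - T)"
        using S T by (intro inv_count_swap) (auto intro: finite_subset)
      ultimately have "even (inv_count T (S - T) + inv_count (S - T) T)" by simp
      then have "gsgn T (S - T) = gsgn (S - T) T" by (simp add: minus_one_power_iff)
      then show ?thesis by simp
    qed simp
  qed
qed

text \<open>Same sign count: (-1)^(|T||U|) = -1 when both cardinalities are odd.\<close>

lemma godd_anticommute:
  assumes "godd x" "godd y" shows "x * y = - (y * x)"
proof (rule grassmann_eqI)
  fix S :: "gen set" assume S: "finite S"
  show "gcoeff (x * y) S = gcoeff (- (y * x)) S"
    unfolding gcoeff_simps(4) gcoeff_times[OF S, of x y] gcoeff_times_swap[OF S, of y x] sum_negf[symmetric]
  proof (rule sum.cong[OF refl])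
    fix T assume T: "T \<in> Pow S"
    show "gsgn T (S - T) * gcoeff x T * gcoeff y (S - T) = - (gsgn (S - T) T * gcoeff y (S - T) * gcoeff x T)"
    proof (cases "gcoeff x T = 0 \<or> gcoeff y (S - T) = 0")
      case False
      then have "odd (card T)" "odd (card (S - T))" using assms by (auto simp: godd_def)
      moreover have "inv_count T (S - T) + inv_count (S - T) T = card T * card (S - T)"
        using S T by (intro inv_count_swap) (auto intro: finite_subset)
      ultimately have "odd (inv_count T (S - T) + inv_count (S - T) T)" by simp
      then have "gsgn T (S - T) = - gsgn (S - T) T" by (auto simp: minus_one_power_iff)
      then show ?thesis by simp
    qed auto
  qed
qed

section \<open>Fresh generators and their cancellation\<close>

definition gavoids :: "gen set \<Rightarrow> grassmann \<Rightarrow> bool" where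
  "gavoids G x \<longleftrightarrow> (\<forall>S. gcoeff x S \<noteq> 0 \<longrightarrow> S \<inter> G = {})"

lemma gavoids_intros [intro, simp]:
  "gavoids G 0" "gavoids G 1" "gavoids G x \<Longrightarrow> gavoids G (- x)"
  unfolding gavoids_def by (auto simp: gcoeff_1 split: if_splits)
lemma gavoids_ggen [simp]: "gavoids G (ggen g) \<longleftrightarrow> g \<notin> G"
  unfolding gavoids_def by (auto simp: gcoeff_ggen)
lemma gavoids_add [intro, simp]: "gavoids G x \<Longrightarrow> gavoids G y \<Longrightarrow> gavoids G (x + y)"
  unfolding gavoids_def by (metis add.right_neutral add_0 gcoeff_simps(2))
lemma gavoids_sum [intro, simp]: "(\<And>i. i \<in> I \<Longrightarrow> gavoids G (f i)) \<Longrightarrow> gavoids G (sum f I)"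
  by (induction I rule: infinite_finite_induct) auto
lemma gavoids_mult [intro, simp]: "gavoids G x \<Longrightarrow> gavoids G y \<Longrightarrow> gavoids G (x * y)"
  unfolding gavoids_def by (auto elim!: gcoeff_times_nonzeroE)

text \<open>If g does not occur in x, the coefficient of x g at S \<union> {g} is, up to sign, that
  of x at S: only the splitting into S and {g} contributes. Hence a fresh generator can be
  cancelled.\<close>

lemma gavoids_mult_ggen_eq_0:
  assumes "x * ggen g = 0" "gavoids {g} x"
  shows "x = 0"
proof (rule grassmann_eqI)
  fix S :: "gen set" assume S: "finite S"
  show "gcoeff x S = gcoeff 0 S"
  proof (cases "g \<in> S")
    case True
    then show ?thesis using assms(2) by (auto simp: gavoids_def)
  next
    case False
    have "gcoeff (x * ggen g) (insert g S) =
        (\<Sum>T\<in>Pow (insert g S). if T = S then gsgn S {g} * gcoeff x S else 0)"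
      unfolding gcoeff_times[OF finite.insertI[OF S]]
    proof (rule sum.cong[OF refl])
      fix T assume "T \<in> Pow (insert g S)"
      then have "insert g S - T = {g} \<longleftrightarrow> T = S" if "g \<notin> T" using False that by auto
      moreover have "insert g S - T \<noteq> {g}" if "g \<in> T" using that by auto
      ultimately show "gsgn T (insert g S - T) * gcoeff x T * gcoeff (ggen g) (insert g S - T) =
          (if T = S then gsgn S {g} * gcoeff x S else 0)"
        using False by (cases "g \<in> T") (auto simp: gcoeff_ggen)
    qed
    also have "\<dots> = gsgn S {g} * gcoeff x S"
      using S by (auto simp: sum.delta)
    finally show ?thesis using assms(1) by simp
  qed
qed

section \<open>The commutative ring of even elements\<close>

text \<open>Made a type of its own so that determinants and adjugates over
  \<open>comm_ring_1\<close> apply to AB.\<close>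

typedef even_grassmann = "{x. geven x}" morphisms gr ev_abs
  by (rule exI[of _ 0]) simp

setup_lifting type_definition_even_grassmann

instantiation even_grassmann :: comm_ring_1
begin
lift_definition zero_even_grassmann :: even_grassmann is 0 by simp
lift_definition one_even_grassmann :: even_grassmann is 1 by simp
lift_definition plus_even_grassmann :: "even_grassmann \<Rightarrow> even_grassmann \<Rightarrow> even_grassmann" is "(+)" by simp
lift_definition minus_even_grassmann :: "even_grassmann \<Rightarrow> even_grassmann \<Rightarrow> even_grassmann" is "(-)" by simp
lift_definition uminus_even_grassmann :: "even_grassmann \<Rightarrow> even_grassmann" is uminus by simp
lift_definition times_even_grassmann :: "even_grassmann \<Rightarrow> even_grassmann \<Rightarrow> even_grassmann" is "(*)" by simp
instance
  by standard (transfer; simp add: algebra_simps geven_commute)+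
end

lemma geven_gr [simp]: "geven (gr x)" using gr[of x] by simp

lemma gr_simps [simp]:
  "gr 0 = 0" "gr 1 = 1" "gr (x + y) = gr x + gr y" "gr (x - y) = gr x - gr y"
  "gr (- x) = - gr x" "gr (x * y) = gr x * gr y"
  by (transfer; simp)+

lemma gr_sum [simp]: "gr (sum f I) = (\<Sum>i\<in>I. gr (f i))"
  by (induction I rule: infinite_finite_induct) auto

lemma gr_eq_0_iff [simp]: "gr x = 0 \<longleftrightarrow> x = 0"
  using gr_inject[of x 0] by simp

lemma gr_commute: "y * gr x = gr x * y"
  by (rule geven_commute[symmetric]) simp

lemma even_grassmann_torsion_free:
  fixes x :: even_grassmann
  assumes "of_nat m * x = 0" "m > 0"
  shows "x = 0"
proof -
  have "gr (of_nat m) = of_nat m" by (induction m) auto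
  with assms show ?thesis using grassmann_torsion_free[of m "gr x"] by (metis gr_eq_0_iff gr_simps(6))
qed

text \<open>Outside of the even part the value is arbitrary; it is used only for products of odd elements.\<close>
definition odd_prod :: "grassmann \<Rightarrow> grassmann \<Rightarrow> even_grassmann" (infixl "\<star>" 70) where
  "u \<star> v = ev_abs (u * v)"

lemma gr_odd_prod [simp]: "godd u \<Longrightarrow> godd v \<Longrightarrow> gr (u \<star> v) = u * v"
  unfolding odd_prod_def by (simp add: ev_abs_inverse)

section \<open>Determinants over commutative rings\<close>

text \<open>The intended \<open>e i k\<close> is z_i w_k with odd z_i, w_k, where exchanging two
  column indices flips the sign; a permutation is built up from such exchanges.\<close>

lemma prod_perm_sign:
  fixes e :: "nat \<Rightarrow> nat \<Rightarrow> 'a :: comm_ring_1"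
  assumes e: "\<And>i j k l. i \<noteq> j \<Longrightarrow> e i k * e j l = - (e i l * e j k)"
    and p: "p permutes {0..<n}"
  shows "(\<Prod>i=0..<n. e i (p i)) = signof p * (\<Prod>i=0..<n. e i i)"
  \<comment> \<open>The transposition is composed on the right, so only the factors with row indices
    a and b change.\<close>
  using finite_atLeastLessThan p
proof (induction rule: permutes_rev_induct)
  case id
  then show ?case by (simp add: sign_id)
next
  case (swap a b p)
  let ?q = "p \<circ> Transposition.transpose a b" and ?N = "{0..<n}"
  have *: "(\<Prod>i\<in>?N. f i) = f a * f b * (\<Prod>i\<in>?N - {a, b}. f i)" for f :: "nat \<Rightarrow> 'a"
  proof -
    have "?N - {a} - {b} = ?N - {a, b}" by auto
    then show ?thesis
      using swap(1-3) by (simp add: prod.remove[of ?N a] prod.remove[of "?N - {a}" b] mult.assoc)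
  qed
  have "(\<Prod>i\<in>?N - {a, b}. e i (?q i)) = (\<Prod>i\<in>?N - {a, b}. e i (p i))"
    by (rule prod.cong) (auto simp: Transposition.transpose_def)
  moreover have "e a (?q a) * e b (?q b) = - (e a (p a) * e b (p b))"
    using e[OF swap(3), of "p b" "p a"] by simp
  ultimately have "(\<Prod>i\<in>?N. e i (?q i)) = - (\<Prod>i\<in>?N. e i (p i))"
    by (simp only: * mult_minus_left)
  moreover have "sign ?q = - sign p"
  proof -
    have "permutation p" using swap(4) by (rule permutes_imp_permutation[OF finite_atLeastLessThan])
    then show ?thesis
      using swap(3) by (simp add: sign_compose sign_swap_id permutation_swap_id)
  qed
  ultimately show ?case by (simp only: swap(5) of_int_minus mult_minus_left)
qed

text \<open>Expand over all choices f of a column in each row. A repeated column gives 0 by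
  \<open>e0\<close>; the injective choices are permutations, and reordering each gives its
  sign.\<close>

lemma prod_sum_eq_det:
  fixes e c :: "nat \<Rightarrow> nat \<Rightarrow> 'a :: comm_ring_1"
  assumes e: "\<And>i j k l. i \<noteq> j \<Longrightarrow> e i k * e j l = - (e i l * e j k)"
    and e0: "\<And>i j k. i \<noteq> j \<Longrightarrow> e i k * e j k = 0"
  shows "(\<Prod>i=0..<n. \<Sum>l=0..<n. c i l * e i l) = det (mat n n (\<lambda>(i, l). c i l)) * (\<Prod>i=0..<n. e i i)"
proof -
  let ?N = "{0..<n}"
  let ?t = "\<lambda>f. \<Prod>i\<in>?N. c i (f i) * e i (f i)"
  have zero: "?t f = 0" if inj: "\<not> inj_on f ?N" for f
  proof -
    obtain i j where ij: "i \<in> ?N" "j \<in> ?N" "i \<noteq> j" "f i = f j"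
      using inj unfolding inj_on_def by blast
    have "?t f = (c i (f i) * e i (f i)) * ((c j (f j) * e j (f j)) *
        (\<Prod>i\<in>?N - {i} - {j}. c i (f i) * e i (f i)))"
      using ij by (simp add: prod.remove[of ?N i] prod.remove[of "?N - {i}" j])
    also have "\<dots> = e i (f i) * e j (f i) * (c i (f i) * c j (f j) *
        (\<Prod>i\<in>?N - {i} - {j}. c i (f i) * e i (f i)))"
      using ij(4) by (simp add: mult_ac)
    finally show ?thesis using e0[OF ij(3)] by simp
  qed
  \<comment> \<open>Functions in \<open>Pi\<^sub>E\<close> are undefined outside the index range,
    whereas permutations must be the identity there; \<open>r\<close> converts between the two
    conventions.\<close>
  define r where "r f = (\<lambda>i. if i \<in> ?N then f i else i)" for f :: "nat \<Rightarrow> nat"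
  have "(\<Prod>i\<in>?N. \<Sum>l\<in>?N. c i l * e i l) = (\<Sum>f\<in>Pi\<^sub>E ?N (\<lambda>_. ?N). ?t f)"
    by (rule prod_sum_PiE) auto
  also have "\<dots> = (\<Sum>f\<in>{f \<in> Pi\<^sub>E ?N (\<lambda>_. ?N). inj_on f ?N}. ?t f)"
    by (rule sum.mono_neutral_right) (auto intro!: finite_PiE simp: zero)
  also have "\<dots> = (\<Sum>p | p permutes ?N. ?t p)"
  proof (rule sum.reindex_bij_witness[of _ "\<lambda>p. restrict p ?N" r], goal_cases)
    case (1 f)
    then show ?case by (auto simp: r_def fun_eq_iff PiE_iff extensional_def)
  next
    case (2 f)
    then have "inj_on f ?N" "f ` ?N \<subseteq> ?N" by auto
    then have "bij_betw f ?N ?N"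
      by (simp add: bij_betw_def endo_inj_surj)
    then have "bij_betw (r f) ?N ?N" by (rule bij_betw_cong[THEN iffD1, rotated]) (simp add: r_def)
    then have "r f permutes ?N" by (rule bij_imp_permutes) (simp add: r_def)
    then show ?case by simp
  next
    case (3 p)
    then show ?case using permutes_not_in[of p ?N] by (auto simp: r_def fun_eq_iff)
  next
    case (4 p)
    then have p: "p permutes ?N" by simp
    have "inj_on (restrict p ?N) ?N"
      using permutes_inj[OF p] by (auto simp: inj_on_def)
    then show ?case using permutes_in_image[OF p] by auto
  next
    case (5 f)
    then show ?case by (auto simp: r_def intro: prod.cong)
  qed
  also have "\<dots> = (\<Sum>p | p permutes ?N. signof p * (\<Prod>i\<in>?N. c i (p i)) * (\<Prod>i\<in>?N. e i i))"
    using prod_perm_sign[of e _ n, OF e] by (intro sum.cong) (simp_all add: prod.distrib mult_ac)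
  also have "\<dots> = (\<Sum>p | p permutes ?N. signof p * (\<Prod>i\<in>?N. c i (p i))) * (\<Prod>i\<in>?N. e i i)"
    by (simp add: sum_distrib_right)
  also have "(\<Sum>p | p permutes ?N. signof p * (\<Prod>i\<in>?N. c i (p i))) = det (mat n n (\<lambda>(i, l). c i l))"
    unfolding det_def by (auto intro!: sum.cong prod.cong arg_cong2[of _ _ _ _ "(*)"] simp: permutes_in_image)
  finally show ?thesis .
qed

section \<open>Jacobi's formula and matrices linear in the variable\<close>

lemma fps_deriv_prod:
  fixes f :: "'i \<Rightarrow> 'a :: comm_ring_1 fps"
  assumes "finite I"
  shows "fps_deriv (\<Prod>i\<in>I. f i) = (\<Sum>i\<in>I. fps_deriv (f i) * (\<Prod>j\<in>I - {i}. f j))"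
  using assms
proof induction
  case (insert x I)
  have "fps_deriv (\<Prod>i\<in>insert x I. f i) =
      fps_deriv (f x) * (\<Prod>i\<in>I. f i) + (\<Sum>i\<in>I. fps_deriv (f i) * (f x * (\<Prod>j\<in>I - {i}. f j)))"
    using insert by (simp add: sum_distrib_left mult_ac)
  also have "(\<Sum>i\<in>I. fps_deriv (f i) * (f x * (\<Prod>j\<in>I - {i}. f j))) =
      (\<Sum>i\<in>I. fps_deriv (f i) * (\<Prod>j\<in>insert x I - {i}. f j))"
  proof (rule sum.cong[OF refl])
    fix i assume i: "i \<in> I"
    with insert have "insert x I - {i} = insert x (I - {i})" by auto
    with insert i show "fps_deriv (f i) * (f x * (\<Prod>j\<in>I - {i}. f j)) =
      fps_deriv (f i) * (\<Prod>j\<in>insert x I - {i}. f j)" by simp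
  qed
  finally show ?case using insert by simp
qed simp

lemma fps_deriv_det:
  fixes M :: "'a :: comm_ring_1 fps mat"
  assumes M: "M \<in> carrier_mat n n"
  shows "fps_deriv (det M) = (\<Sum>i<n. \<Sum>j<n. fps_deriv (M $$ (i, j)) * cofactor M i j)"
proof -
  let ?N = "{0..<n}"
  \<comment> \<open>\<open>R i\<close> is M with row i differentiated. The product rule gives the
    sum of the \<open>det (R i)\<close>; expanding each along row i leaves the cofactors of
    M.\<close>
  define R where "R i = mat n n (\<lambda>(r, c). if r = i then fps_deriv (M $$ (i, c)) else M $$ (r, c))" for i
  have sgn: "fps_deriv (signof p * x) = signof p * fps_deriv x" for p and x :: "'a fps"
    by (cases "sign p = 1") (auto simp: sign_def)
  have "fps_deriv (det M) = (\<Sum>p | p permutes ?N. signof p *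
      (\<Sum>i\<in>?N. fps_deriv (M $$ (i, p i)) * (\<Prod>j\<in>?N - {i}. M $$ (j, p j))))"
    unfolding det_def'[OF M] fps_deriv_sum sgn by (simp add: fps_deriv_prod)
  also have "\<dots> = (\<Sum>p | p permutes ?N. \<Sum>i\<in>?N. signof p * (\<Prod>j\<in>?N. R i $$ (j, p j)))"
    unfolding sum_distrib_left
  proof (intro sum.cong refl)
    fix p i assume "p \<in> {p. p permutes ?N}" and i: "i \<in> ?N"
    then have p: "p permutes ?N" by simp
    have "(\<Prod>j\<in>?N. R i $$ (j, p j)) = R i $$ (i, p i) * (\<Prod>j\<in>?N - {i}. R i $$ (j, p j))"
      using i by (simp add: prod.remove)
    also have "R i $$ (i, p i) = fps_deriv (M $$ (i, p i))"
      using i permutes_in_image[OF p, of i] by (simp add: R_def)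
    also have "(\<Prod>j\<in>?N - {i}. R i $$ (j, p j)) = (\<Prod>j\<in>?N - {i}. M $$ (j, p j))"
      using permutes_in_image[OF p] by (intro prod.cong) (auto simp: R_def)
    finally show "signof p * (fps_deriv (M $$ (i, p i)) * (\<Prod>j\<in>?N - {i}. M $$ (j, p j))) =
      signof p * (\<Prod>j\<in>?N. R i $$ (j, p j))" by simp
  qed
  also have "\<dots> = (\<Sum>i\<in>?N. det (R i))"
  proof -
    have "det (R i) = (\<Sum>p | p permutes ?N. signof p * (\<Prod>j\<in>?N. R i $$ (j, p j)))" for i
      by (rule det_def') (simp add: R_def)
    then show ?thesis by (subst sum.swap) simp
  qed
  also have "\<dots> = (\<Sum>i<n. \<Sum>j<n. fps_deriv (M $$ (i, j)) * cofactor M i j)"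
    unfolding atLeast0LessThan
  proof (intro sum.cong refl)
    fix i assume i: "i \<in> {..<n}"
    have "mat_delete (R i) i j = mat_delete M i j" if "j < n" for j
      using M i that by (intro eq_matI) (auto simp: mat_delete_def R_def)
    then have "cofactor (R i) i j = cofactor M i j" if "j < n" for j
      using that by (simp add: cofactor_def)
    then show "det (R i) = (\<Sum>j<n. fps_deriv (M $$ (i, j)) * cofactor M i j)"
      using i by (subst laplace_expansion_row[of _ n i]) (auto simp: R_def intro!: sum.cong)
  qed
  finally show ?thesis .
qed

text \<open>The degree bound in the first conjunct is what lets the induction isolate the top
  coefficient.\<close>

lemma fps_nth_prod_linear:
  fixes u v :: "nat \<Rightarrow> 'a :: comm_ring_1"
  shows "(\<forall>k>n. fps_nth (\<Prod>i=0..<n. fps_const (u i) + fps_X * fps_const (v i)) k = 0) \<and>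
    fps_nth (\<Prod>i=0..<n. fps_const (u i) + fps_X * fps_const (v i)) n = (\<Prod>i=0..<n. v i)"
proof (induction n)
  case (Suc n)
  let ?P = "\<Prod>i=0..<n. fps_const (u i) + fps_X * fps_const (v i)"
  have "fps_nth (\<Prod>i=0..<Suc n. fps_const (u i) + fps_X * fps_const (v i)) k =
      u n * fps_nth ?P k + (if k = 0 then 0 else v n * fps_nth ?P (k - 1))" for k
  proof -
    have "(\<Prod>i=0..<Suc n. fps_const (u i) + fps_X * fps_const (v i)) =
        fps_const (u n) * ?P + fps_X * (fps_const (v n) * ?P)"
      by (simp add: algebra_simps)
    then show ?thesis by simp
  qed
  with Suc show ?case by (auto simp: mult.commute)
qed auto

text \<open>Serves to read off the t^(n-1) coefficient of the minors of 1 - tC.\<close>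

lemma fps_nth_det_linear:
  fixes U V :: "nat \<Rightarrow> nat \<Rightarrow> 'a :: comm_ring_1"
  shows "fps_nth (det (mat n n (\<lambda>(i, j). fps_const (U i j) + fps_X * fps_const (V i j)))) n =
    det (mat n n (\<lambda>(i, j). V i j))"
proof -
  have sgn: "fps_nth (signof p * x) n = signof p * fps_nth x n" for p and x :: "'a fps"
    by (cases "sign p = 1") (auto simp: sign_def)
  have "(\<Prod>i=0..<n. mat n n (\<lambda>(i, j). fps_const (U i j) + fps_X * fps_const (V i j)) $$ (i, p i)) =
      (\<Prod>i=0..<n. fps_const (U i (p i)) + fps_X * fps_const (V i (p i)))"
    "(\<Prod>i=0..<n. mat n n (\<lambda>(i, j). V i j) $$ (i, p i)) = (\<Prod>i=0..<n. V i (p i))"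
    if "p permutes {0..<n}" for p
    using permutes_in_image[OF that] by (auto intro!: prod.cong)
  then show ?thesis
    using fps_nth_prod_linear[of n "\<lambda>i. U i (p i)" "\<lambda>i. V i (p i)" for p]
    by (simp add: det_def'[of _ n] fps_sum_nth sgn)
qed

text \<open>Jacobi's formula for the derivative of \<open>det (1 - tC)\<close> expresses it by the traces of powers.\<close>
lemma adj_mat_uminus_eq_pow:
  fixes C :: "'a :: comm_ring_1 mat"
  assumes C: "C \<in> carrier_mat n n"
    and torsion_free: "\<And>m (x :: 'a). of_nat m * x = 0 \<Longrightarrow> m > 0 \<Longrightarrow> x = 0"
    and trace: "\<And>k. k > 0 \<Longrightarrow> (\<Sum>i<n. (C ^\<^sub>m k) $$ (i, i)) = 0"
  shows "adj_mat (- C) = C ^\<^sub>m (n - 1)"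
proof -
  \<comment> \<open>M is 1 - tC and G is the geometric series of the t^k C^k, its inverse.\<close>
  define M where "M = mat n n (\<lambda>(i, j). fps_const (if i = j then 1 else 0) + fps_X * fps_const (- C $$ (i, j)))"
  define G where "G = mat n n (\<lambda>(i, j). Abs_fps (\<lambda>k. (C ^\<^sub>m k) $$ (i, j)))"
  have M: "M \<in> carrier_mat n n" and G: "G \<in> carrier_mat n n" by (auto simp: M_def G_def)
  have Gnth: "fps_nth (G $$ (i, j)) k = (C ^\<^sub>m k) $$ (i, j)" if "i < n" "j < n" for i j k
    using that by (simp add: G_def)
  note adj = adj_mat[OF M]
  have GM: "G * M = 1\<^sub>m n"
  proof (rule eq_matI, goal_cases)
    case (1 i j)
    then have ij: "i < n" "j < n" by auto
    have "fps_nth ((G * M) $$ (i, j)) k = fps_nth (if i = j then 1 else 0) k" for k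
    proof -
      have "(G * M) $$ (i, j) = (\<Sum>l=0..<n. G $$ (i, l) * M $$ (l, j))"
        using ij G M by (simp add: scalar_prod_def)
      also have "\<dots> = (\<Sum>l=0..<n. (if l = j then G $$ (i, l) else 0)
          - fps_X * (G $$ (i, l) * fps_const (C $$ (l, j))))"
        using ij by (intro sum.cong) (auto simp: M_def algebra_simps fps_const_neg[symmetric] simp del: fps_const_neg)
      also have "\<dots> = G $$ (i, j) - fps_X * (\<Sum>l=0..<n. G $$ (i, l) * fps_const (C $$ (l, j)))"
        using ij by (simp add: sum_subtractf sum_distrib_left sum.delta)
      finally have *: "(G * M) $$ (i, j) = \<dots>" .
      show ?thesis
      proof (cases k)
        case 0
        then show ?thesis using ij C by (auto simp: * Gnth)
      next
        case (Suc k')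
        have "(C ^\<^sub>m k) $$ (i, j) = (\<Sum>l=0..<n. (C ^\<^sub>m k') $$ (i, l) * C $$ (l, j))"
          using ij C by (auto simp: Suc scalar_prod_def)
        then show ?thesis using ij by (auto simp: * Gnth Suc fps_sum_nth)
      qed
    qed
    then show ?case using ij by (auto intro: fps_ext)
  qed (use G M in auto)
  \<comment> \<open>Multiply M adj M = det M by G from the left.\<close>
  have adj_eq: "adj_mat M = det M \<cdot>\<^sub>m G"
  proof -
    have "adj_mat M = (G * M) * adj_mat M" using adj by (simp add: GM)
    also have "\<dots> = G * (M * adj_mat M)" using G M adj by (simp add: assoc_mult_mat[of _ n n _ n _ n])
    also have "\<dots> = det M \<cdot>\<^sub>m G" using G adj by (simp add: mult_smult_distrib[of _ n n _ n])
    finally show ?thesis .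
  qed
  have cof: "cofactor M i j = det M * G $$ (j, i)" if "i < n" "j < n" for i j
  proof -
    have "cofactor M i j = adj_mat M $$ (j, i)" using that M by (simp add: adj_mat_def)
    then show ?thesis using that G by (simp add: adj_eq)
  qed
  \<comment> \<open>In Jacobi's formula the cofactors become det M times entries of G, so the double
    sum is the generating function of the traces of C^(k+1), which vanish.\<close>
  have "fps_deriv (det M) = - (det M * (\<Sum>i<n. \<Sum>j<n. G $$ (j, i) * fps_const (C $$ (i, j))))"
  proof -
    have "fps_deriv (M $$ (i, j)) = - fps_const (C $$ (i, j))" if "i < n" "j < n" for i j
      using that by (simp add: M_def)
    then have "fps_deriv (det M) = (\<Sum>i<n. \<Sum>j<n. - (det M * (G $$ (j, i) * fps_const (C $$ (i, j)))))"
      unfolding fps_deriv_det[OF M] by (intro sum.cong) (auto simp: cof simp del: fps_const_neg)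
    then show ?thesis by (simp only: sum_negf sum_distrib_left)
  qed
  also have "(\<Sum>i<n. \<Sum>j<n. G $$ (j, i) * fps_const (C $$ (i, j))) = 0"
  proof (rule fps_ext)
    fix k
    have "fps_nth (\<Sum>i<n. \<Sum>j<n. G $$ (j, i) * fps_const (C $$ (i, j))) k =
        (\<Sum>j<n. \<Sum>i<n. (C ^\<^sub>m k) $$ (j, i) * C $$ (i, j))"
      by (subst sum.swap) (simp add: fps_sum_nth Gnth)
    also have "\<dots> = (\<Sum>j<n. (C ^\<^sub>m Suc k) $$ (j, j))"
      using C by (intro sum.cong) (auto simp: scalar_prod_def atLeast0LessThan)
    finally show "fps_nth (\<Sum>i<n. \<Sum>j<n. G $$ (j, i) * fps_const (C $$ (i, j))) k = fps_nth 0 k"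
      using trace[of "Suc k"] by simp
  qed
  finally have deriv: "fps_deriv (det M) = 0" by simp
  \<comment> \<open>The constant term is the determinant of the identity. A higher coefficient,
    multiplied by its index, is a coefficient of the zero derivative, so it vanishes by
    torsion-freeness.\<close>
  have det: "det M = 1"
  proof (rule fps_ext)
    fix k
    show "fps_nth (det M) k = fps_nth 1 k"
    proof (cases k)
      case 0
      have "fps_nth (det M) 0 = det (map_mat (\<lambda>f. fps_nth f 0) M)"
      proof -
        have [simp]: "fps_nth (signof p :: 'a fps) 0 = signof p" for p
          by (cases "sign p = 1") (auto simp: sign_def)
        have [simp]: "fps_nth (prod f I) 0 = (\<Prod>i\<in>I. fps_nth (f i) 0)" for f :: "nat \<Rightarrow> 'a fps" and I
          by (induction I rule: infinite_finite_induct) auto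
        show ?thesis using M by (auto simp: det_def fps_sum_nth permutes_in_image intro!: sum.cong prod.cong arg_cong2[of _ _ _ _ "(*)"])
      qed
      also have "map_mat (\<lambda>f. fps_nth f 0) M = 1\<^sub>m n" by (rule eq_matI) (auto simp: M_def)
      finally show ?thesis using 0 by simp
    next
      case (Suc m)
      have "of_nat (Suc m) * fps_nth (det M) (Suc m) = 0"
        using arg_cong[OF deriv, of "\<lambda>f. fps_nth f m"] by simp
      then have "fps_nth (det M) (Suc m) = 0" by (rule torsion_free) simp
      then show ?thesis using Suc by simp
    qed
  qed
  show ?thesis
  proof (rule eq_matI, goal_cases)
    case (1 i j)
    then have ij: "i < n" "j < n" using C by (auto split: if_splits)
    \<comment> \<open>With det M = 1 the cofactors of M are entries of G. Compare coefficients at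
      t^(n-1): a minor of M has size n - 1, so its top coefficient is the minor of -C, while G
      contributes C^(n-1).\<close>
    let ?d = "\<lambda>f. mat (n - 1) (n - 1) (\<lambda>(r, c). f (if r < j then r else Suc r) (if c < i then c else Suc c))"
    have "mat_delete M j i = ?d (\<lambda>r c. fps_const (if r = c then 1 else 0) + fps_X * fps_const (- C $$ (r, c)))"
      unfolding mat_delete_def using M ij by (intro eq_matI) (auto simp: M_def)
    then have "fps_nth (det (mat_delete M j i)) (n - 1) = det (?d (\<lambda>r c. - C $$ (r, c)))"
      using fps_nth_det_linear[of "n - 1"
          "\<lambda>r c. if (if r < j then r else Suc r) = (if c < i then c else Suc c) then 1 else 0"
          "\<lambda>r c. - C $$ (if r < j then r else Suc r, if c < i then c else Suc c)"] by simp
    also have "?d (\<lambda>r c. - C $$ (r, c)) = mat_delete (- C) j i"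
      unfolding mat_delete_def using C ij by (intro eq_matI) auto
    finally have "fps_nth (cofactor M j i) (n - 1) = cofactor (- C) j i"
      by (cases "even (i + j)") (auto simp: cofactor_def add.commute)
    moreover have "cofactor M j i = G $$ (i, j)" using cof[of j i] ij det by simp
    ultimately show ?case using ij C by (simp add: adj_mat_def G_def)
  qed (use C in \<open>auto simp: adj_mat_def pow_mat_dim_square[OF C]\<close>)
qed

section \<open>Skew-symmetric matrices of odd elements\<close>

lemma gr_eqI: "gr x = gr y \<Longrightarrow> x = y"
  by (simp add: gr_inject)

lemma odd_prod_minus_left: "godd u \<Longrightarrow> godd v \<Longrightarrow> (- u) \<star> v = - (u \<star> v)"
  by (rule gr_eqI) simp

text \<open>Move the even product w v past u, then anticommute w and v: z u w v = z w v u = - z v w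
  u.\<close>

lemma odd_prod_exchange:
  assumes "godd u" "godd v" "godd z" "godd w"
  shows "(z \<star> u) * (w \<star> v) = - ((z \<star> v) * (w \<star> u))"
proof (rule gr_eqI)
  have wv: "w * v = - (v * w)" using assms by (intro godd_anticommute)
  have "z * u * (w * v) = z * (u * (w * v))" by (simp add: mult.assoc)
  also have "\<dots> = z * (w * v * u)" using assms by (subst geven_commute[of "w * v" u]) auto
  also have "\<dots> = - (z * v * (w * u))" unfolding wv by (simp add: mult.assoc)
  finally show "gr ((z \<star> u) * (w \<star> v)) = gr (- ((z \<star> v) * (w \<star> u)))"
    using assms by simp
qed

lemma odd_prod_same_right:
  assumes "godd u" "godd z" "godd w"
  shows "(z \<star> u) * (w \<star> u) = 0"
proof -
  have "(z \<star> u) * (w \<star> u) + (z \<star> u) * (w \<star> u) = 0"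
    using odd_prod_exchange[OF assms(1,1,2,3)] unfolding eq_neg_iff_add_eq_0 .
  then have "of_nat 2 * ((z \<star> u) * (w \<star> u)) = 0" by (simp only: of_nat_numeral mult_2)
  then show ?thesis by (rule even_grassmann_torsion_free) simp
qed

text \<open>The leading coefficient of p survives multiplication by a monic factor, even in the
  presence of zero divisors.\<close>

lemma monic_linear_mult_eq_0:
  fixes p :: "'a :: comm_ring_1 poly"
  assumes "[:c, 1:] * p = 0" shows "p = 0"
proof (rule ccontr)
  assume "p \<noteq> 0"
  have "coeff ([:c, 1:] * p) (Suc (degree p)) = lead_coeff p"
    by (simp add: coeff_eq_0)
  with assms \<open>p \<noteq> 0\<close> show False by simp
qed

lemma sum_pCons3: "(\<Sum>i\<in>I. [:p i, q i, r i:]) = [:\<Sum>i\<in>I. p i, \<Sum>i\<in>I. q i, \<Sum>i\<in>I. r i:]"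
  by (induction I rule: infinite_finite_induct) auto

text \<open>Multiplying \<open>y_i\<close> by an odd \<open>z_i\<close> moves the product into the commutative ring. The relation
  \<open>\<Sum>_i x_i y_i = 0\<close> only gives \<open>x_0 \<Prod>_i z_i y_i = 0\<close>; to be able to cancel \<open>x_0\<close> it is replaced by
  \<open>x_0 + s\<close> with a polynomial variable \<open>s\<close>, which makes it monic.\<close>
lemma prod_skew_form_eq_0:
  fixes a :: "nat \<Rightarrow> nat \<Rightarrow> grassmann" and x :: "nat \<Rightarrow> even_grassmann"
  assumes a: "\<And>i j. godd (a i j)" and skew: "\<And>i j. a j i = - a i j"
    and z: "\<And>i. godd (z i)" and n: "n > 0"
  shows "(\<Prod>i=0..<n. z i \<star> (\<Sum>j=0..<n. gr (x j) * a i j)) = 0"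
proof -
  define y where "y i = (\<Sum>j=0..<n. gr (x j) * a i j)" for i
  have y: "godd (y i)" for i using a by (auto simp: y_def)
  have a_diag: "a i i = 0" for i
  proof -
    have "of_nat 2 * a i i = 0" using skew[of i i] by (simp add: eq_neg_iff_add_eq_0 mult_2)
    then show ?thesis by (rule grassmann_torsion_free) simp
  qed
  \<comment> \<open>The terms of the double sum are skew in i and j, so the sum equals its own
    negative.\<close>
  have xy: "(\<Sum>i=0..<n. gr (x i) * y i) = 0" (is "?s = 0")
  proof -
    have s: "?s = (\<Sum>i=0..<n. \<Sum>j=0..<n. gr (x i) * gr (x j) * a i j)"
      by (simp add: y_def sum_distrib_left mult.assoc)
    also have "\<dots> = (\<Sum>i=0..<n. \<Sum>j=0..<n. gr (x j) * gr (x i) * a j i)"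
      by (rule sum.swap)
    also have "\<dots> = (\<Sum>i=0..<n. \<Sum>j=0..<n. - (gr (x i) * gr (x j) * a i j))"
    proof (intro sum.cong refl)
      fix i j
      show "gr (x j) * gr (x i) * a j i = - (gr (x i) * gr (x j) * a i j)"
        by (subst skew, subst gr_commute) (rule mult_minus_right)
    qed
    also have "\<dots> = - ?s" by (simp only: s sum_negf)
    finally have "?s = - ?s" .
    then have "of_nat 2 * ?s = 0" by (simp add: eq_neg_iff_add_eq_0 mult_2)
    then show ?thesis by (rule grassmann_torsion_free) simp
  qed
  \<comment> \<open>Replacing x_0 by x_0 + s changes y_i to y_i + s a_i0; \<open>h m i\<close> is
    z_m times this, and \<open>X i\<close> is the perturbed coefficient.\<close>
  define h where "h m i = [:z m \<star> y i, z m \<star> a i 0:]" for m i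
  define X where "X i = [:x i, if i = 0 then 1 else 0:]" for i :: nat
  have "(\<Sum>i=0..<n. X i * h 0 i) = [:\<Sum>i=0..<n. x i * (z 0 \<star> y i),
      \<Sum>i=0..<n. x i * (z 0 \<star> a i 0) + (if i = 0 then z 0 \<star> y i else 0),
      \<Sum>i=0..<n. if i = 0 then z 0 \<star> a i 0 else 0:]"
    unfolding sum_pCons3[symmetric] by (intro sum.cong) (auto simp: X_def h_def)
  also have "\<dots> = 0"
  \<comment> \<open>The coefficients of 1, s and s^2 vanish by \<open>xy\<close>, by y_0 = -
    \<Sum>_i x_i a_i0, and by a_00 = 0, respectively.\<close>
  proof -
    have "(\<Sum>i=0..<n. x i * (z 0 \<star> y i)) = 0"
    proof (rule gr_eqI)
      have "gr (\<Sum>i=0..<n. x i * (z 0 \<star> y i)) = z 0 * (\<Sum>i=0..<n. gr (x i) * y i)"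
        using y z by (simp add: sum_distrib_left mult.assoc[symmetric] gr_commute[of "z 0"])
      then show "gr (\<Sum>i=0..<n. x i * (z 0 \<star> y i)) = gr 0" by (simp add: xy)
    qed
    moreover have "(\<Sum>i=0..<n. x i * (z 0 \<star> a i 0) + (if i = 0 then z 0 \<star> y i else 0)) = 0"
    proof (rule gr_eqI)
      have y0: "y 0 = - (\<Sum>i=0..<n. gr (x i) * a i 0)"
        unfolding y_def sum_negf[symmetric] by (intro sum.cong refl) (subst skew, simp)
      have "gr (z 0 \<star> y 0) = z 0 * y 0" using y z by simp
      also have "\<dots> = - (z 0 * (\<Sum>i=0..<n. gr (x i) * a i 0))" by (simp add: y0)
      finally have "gr (z 0 \<star> y 0) = - (z 0 * (\<Sum>i=0..<n. gr (x i) * a i 0))" .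
      moreover have "gr (\<Sum>i=0..<n. x i * (z 0 \<star> a i 0)) = z 0 * (\<Sum>i=0..<n. gr (x i) * a i 0)"
        using a z by (simp add: sum_distrib_left mult.assoc[symmetric] gr_commute[of "z 0"])
      ultimately show "gr (\<Sum>i=0..<n. x i * (z 0 \<star> a i 0) + (if i = 0 then z 0 \<star> y i else 0)) = gr 0"
        using n by (simp add: sum.distrib del: gr_sum gr_odd_prod)
    qed
    moreover have "z 0 \<star> a 0 0 = 0" using z a by (intro gr_eqI) (simp add: a_diag)
    ultimately show ?thesis using n by simp
  qed
  finally have Xh: "(\<Sum>i=0..<n. X i * h 0 i) = 0" .
  \<comment> \<open>Both factors contain the odd element y_i + s a_i0, whose square is zero.\<close>
  have hh: "h 0 i * h i i = 0" for i
    using odd_prod_same_right[of "y i" "z 0" "z i"] odd_prod_same_right[of "a i 0" "z 0" "z i"]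
      odd_prod_exchange[of "y i" "a i 0" "z 0" "z i"] a y z
    by (simp add: h_def mult.commute[of "z i \<star> _" "z 0 \<star> _"])
  \<comment> \<open>The relation \<open>Xh\<close> trades X_0 h_00 for terms with
    \<open>h 0 i\<close>, i > 0, each of which is killed by the factor \<open>h i i\<close> of
    \<open>?Q\<close>.\<close>
  let ?Q = "\<Prod>i\<in>{0..<n} - {0}. h i i"
  have "X 0 * (\<Prod>i=0..<n. h i i) = X 0 * h 0 0 * ?Q"
    using n by (simp add: prod.remove[of _ 0] mult.assoc)
  also have "X 0 * h 0 0 = - (\<Sum>i\<in>{0..<n} - {0}. X i * h 0 i)"
    using n Xh by (simp add: sum.remove[of _ 0] eq_neg_iff_add_eq_0)
  also have "- (\<Sum>i\<in>{0..<n} - {0}. X i * h 0 i) * ?Q = - (\<Sum>i\<in>{0..<n} - {0}. X i * h 0 i * ?Q)"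
    by (simp add: sum_distrib_right)
  also have "(\<Sum>i\<in>{0..<n} - {0}. X i * h 0 i * ?Q) = 0"
  proof (rule sum.neutral, rule ballI)
    fix i assume "i \<in> {0..<n} - {0}"
    then have "?Q = h i i * (\<Prod>i\<in>{0..<n} - {0} - {i}. h i i)" by (simp add: prod.remove)
    then have "X i * h 0 i * ?Q = X i * (h 0 i * h i i) * (\<Prod>i\<in>{0..<n} - {0} - {i}. h i i)"
      by (simp only: mult.assoc)
    then show "X i * h 0 i * ?Q = 0" by (simp add: hh)
  qed
  finally have "[:x 0, 1:] * (\<Prod>i=0..<n. h i i) = 0" by (simp add: X_def)
  then have "(\<Prod>i=0..<n. h i i) = 0" by (rule monic_linear_mult_eq_0)
  \<comment> \<open>Setting s = 0 recovers the unperturbed product.\<close>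
  then have "poly (\<Prod>i=0..<n. h i i) 0 = 0" by simp
  then show ?thesis by (simp add: poly_prod h_def y_def)
qed

lemma gavoids_gr_prod: "(\<And>i. i \<in> I \<Longrightarrow> gavoids G (gr (f i))) \<Longrightarrow> gavoids G (gr (prod f I))"
  by (induction I rule: infinite_finite_induct) auto

lemma gavoids_gr_det:
  assumes "M \<in> carrier_mat n n" "\<And>i j. i < n \<Longrightarrow> j < n \<Longrightarrow> gavoids G (gr (M $$ (i, j)))"
  shows "gavoids G (gr (det M))"
proof -
  have "gavoids G (gr (signof p * (\<Prod>i=0..<n. M $$ (i, p i))))" if "p permutes {0..<n}" for p
  proof -
    have "gavoids G (gr (\<Prod>i=0..<n. M $$ (i, p i)))"
      using permutes_in_image[OF that] assms(2) by (intro gavoids_gr_prod) auto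
    then show ?thesis by (cases "sign p = 1") (auto simp: sign_def)
  qed
  then show ?thesis by (auto simp: det_def'[OF assms(1)])
qed

text \<open>The generators are cancelled one at a time from the right; their distinctness keeps each
  one fresh for what remains.\<close>

lemma mult_prod_gens_eq_0:
  fixes z w :: "nat \<Rightarrow> gen"
  assumes "inj z" "inj w" "range z \<inter> range w = {}"
    and "gavoids (range z \<union> range w) (gr x)"
    and "x * (\<Prod>i=0..<n. ggen (z i) \<star> ggen (w i)) = 0"
  shows "x = 0"
  using assms(5)
proof (induction n)
  case (Suc n)
  let ?P = "\<Prod>i=0..<n. ggen (z i) \<star> ggen (w i)"
  have x: "gavoids {z n} (gr x)" "gavoids {w n} (gr x)"
    using assms(4) unfolding gavoids_def by blast+
  have zw: "z i \<noteq> w j" "w j \<noteq> z i" for i j using assms(3) by (auto simp: disjoint_iff)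
  have P: "gavoids {z n} (gr ?P)" "gavoids {w n} (gr ?P)"
    using assms(1,2) by (auto intro!: gavoids_gr_prod gavoids_mult simp: inj_eq zw)
  have "gr (x * ?P) * ggen (z n) * ggen (w n) = gr (x * (\<Prod>i=0..<Suc n. ggen (z i) \<star> ggen (w i)))"
    by (simp add: mult.assoc)
  also have "\<dots> = 0" using Suc.prems by simp
  finally have "gr (x * ?P) * ggen (z n) * ggen (w n) = 0" .
  then have "gr (x * ?P) * ggen (z n) = 0"
    by (rule gavoids_mult_ggen_eq_0) (use x P zw in auto)
  then have "gr (x * ?P) = 0"
    by (rule gavoids_mult_ggen_eq_0) (use x P in auto)
  then show ?case by (intro Suc.IH) (simp only: gr_eq_0_iff)
qed simp

definition odd_mat_prod :: "nat \<Rightarrow> (nat \<Rightarrow> nat \<Rightarrow> grassmann) \<Rightarrow> (nat \<Rightarrow> nat \<Rightarrow> grassmann) \<Rightarrow> even_grassmann mat" where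
  "odd_mat_prod n a b = mat n n (\<lambda>(i, l). \<Sum>j=0..<n. a i j \<star> b j l)"

lemma odd_mat_prod_carrier [simp]: "odd_mat_prod n a b \<in> carrier_mat n n"
  by (simp add: odd_mat_prod_def)

lemma gr_odd_mat_prod:
  assumes "\<And>i j. godd (a i j)" "\<And>i j. godd (b i j)" "i < n" "l < n"
  shows "gr (odd_mat_prod n a b $$ (i, l)) = (\<Sum>j=0..<n. a i j * b j l)"
  using assms by (simp add: odd_mat_prod_def)

text \<open>With \<open>e i l\<close> = z_i w_l, the product of the row sums is both det C times
  \<Prod>_i z_i w_i and the product of the z_i y_i, which vanishes. The fresh generators are then
  cancelled.\<close>

lemma det_skew_odd_mat_prod:
  fixes z w :: "nat \<Rightarrow> gen"
  assumes a: "\<And>i j. godd (a i j)" and skew: "\<And>i j. a j i = - a i j"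
    and b: "\<And>i j. godd (b i j)" and n: "n > 0"
    and inj: "inj z" "inj w" "range z \<inter> range w = {}"
    and fresh: "\<And>i j. gavoids (range z \<union> range w) (a i j)" "\<And>i j. gavoids (range z \<union> range w) (b i j)"
  shows "det (odd_mat_prod n a b) = 0"
proof -
  let ?C = "odd_mat_prod n a b"
  define e where "e i l = ggen (z i) \<star> ggen (w l)" for i l
  define x where "x j = (\<Sum>l=0..<n. b j l \<star> ggen (w l))" for j
  have "(\<Sum>l=0..<n. (\<Sum>j=0..<n. a i j \<star> b j l) * e i l) =
      ggen (z i) \<star> (\<Sum>j=0..<n. gr (x j) * a i j)" for i
  proof (rule gr_eqI)
    have "a i j * b j l * (ggen (z i) * ggen (w l)) = ggen (z i) * (b j l * ggen (w l) * a i j)" for j l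
    proof -
      have "b j l * ggen (w l) * a i j = a i j * (b j l * ggen (w l))"
        using b by (intro geven_commute) auto
      then have "ggen (z i) * (b j l * ggen (w l) * a i j) = ggen (z i) * (a i j * b j l) * ggen (w l)"
        by (simp add: mult.assoc)
      also have "ggen (z i) * (a i j * b j l) = a i j * b j l * ggen (z i)"
        using a b by (intro geven_commute[symmetric]) auto
      finally show ?thesis by (simp add: mult.assoc)
    qed
    then have "gr (\<Sum>l=0..<n. (\<Sum>j=0..<n. a i j \<star> b j l) * e i l) =
        (\<Sum>l=0..<n. \<Sum>j=0..<n. ggen (z i) * (b j l * ggen (w l) * a i j))"
      using a b by (simp add: e_def sum_distrib_right)
    also have "\<dots> = gr (ggen (z i) \<star> (\<Sum>j=0..<n. gr (x j) * a i j))"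
      using a b by (subst sum.swap) (simp add: x_def sum_distrib_left sum_distrib_right)
    finally show "gr (\<Sum>l=0..<n. (\<Sum>j=0..<n. a i j \<star> b j l) * e i l) = \<dots>" .
  qed
  then have "(\<Prod>i=0..<n. \<Sum>l=0..<n. (\<Sum>j=0..<n. a i j \<star> b j l) * e i l) = 0"
    using prod_skew_form_eq_0[OF a skew _ n, of "\<lambda>i. ggen (z i)" x] by simp
  moreover have "(\<Prod>i=0..<n. \<Sum>l=0..<n. (\<Sum>j=0..<n. a i j \<star> b j l) * e i l) =
      det ?C * (\<Prod>i=0..<n. e i i)"
    unfolding odd_mat_prod_def
    by (rule prod_sum_eq_det) (auto simp: e_def intro: odd_prod_exchange odd_prod_same_right)
  ultimately have "det ?C * (\<Prod>i=0..<n. e i i) = 0" by simp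
  moreover have "gavoids (range z \<union> range w) (gr (det ?C))"
    using fresh a b by (intro gavoids_gr_det[of _ n]) (auto simp: gr_odd_mat_prod)
  ultimately show ?thesis using mult_prod_gens_eq_0[OF inj] unfolding e_def by blast
qed

section \<open>Vanishing of the traces of powers of AB\<close>

lemma pow_mat_commute:
  fixes C :: "'a :: comm_ring_1 mat"
  assumes C: "C \<in> carrier_mat n n"
  shows "C * C ^\<^sub>m k = C ^\<^sub>m k * C"
proof (induction k)
  case (Suc k)
  have P: "C ^\<^sub>m k \<in> carrier_mat n n" using C by simp
  have "C * (C ^\<^sub>m k * C) = C * C ^\<^sub>m k * C" using assoc_mult_mat[OF C P C] by simp
  then show ?case using Suc by simp
qed (use C in simp)

lemma gr_mat_mult:
  assumes "P \<in> carrier_mat n n" "Q \<in> carrier_mat n n" "i < n" "l < n"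
  shows "gr ((P * Q) $$ (i, l)) = (\<Sum>r<n. gr (P $$ (i, r)) * gr (Q $$ (r, l)))"
  using assms by (simp add: scalar_prod_def atLeast0LessThan)

text \<open>With C = AB, P = C^m and t = tr (P A B), moving the odd B to the front gives t = - tr (B
  P A) = - tr (P^T B A) = - tr (P^T C^T) = - t.\<close>

lemma trace_odd_mat_prod_pow:
  assumes a: "\<And>i j. godd (a i j)" and skew: "\<And>i j. a j i = - a i j"
    and b: "\<And>i j. godd (b i j)" and sym: "\<And>i j. b j i = b i j" and k: "k > 0"
  shows "(\<Sum>i<n. (odd_mat_prod n a b ^\<^sub>m k) $$ (i, i)) = 0"
proof -
  define C where "C = odd_mat_prod n a b"
  have C: "C \<in> carrier_mat n n" by (simp add: C_def)
  have grC: "gr (C $$ (i, l)) = (\<Sum>j<n. a i j * b j l)" if "i < n" "l < n" for i l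
    using that a b by (simp add: C_def gr_odd_mat_prod atLeast0LessThan)
  \<comment> \<open>BA = C^T: the sign from anticommuting cancels the sign from
    skew-symmetry.\<close>
  have ba: "(\<Sum>l<n. b i l * a l j) = gr (C $$ (j, i))" if "i < n" "j < n" for i j
  proof -
    have "b i l * a l j = a j l * b l i" for l
      using godd_anticommute[OF b[of i l] a[of l j]] skew[of l j] sym[of i l] by simp
    then show ?thesis using that by (simp add: grC)
  qed
  \<comment> \<open>B (AB) = (BA) B gives B C = C^T B; \<open>bP\<close> extends this to powers of
    C.\<close>
  have bC: "(\<Sum>r<n. b i r * gr (C $$ (r, l))) = (\<Sum>r<n. gr (C $$ (r, i)) * b r l)"
    if "i < n" "l < n" for i l
  proof -
    have "(\<Sum>r<n. b i r * gr (C $$ (r, l))) = (\<Sum>r<n. \<Sum>s<n. b i r * a r s * b s l)"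
      using that by (simp add: grC sum_distrib_left mult.assoc)
    also have "\<dots> = (\<Sum>s<n. (\<Sum>r<n. b i r * a r s) * b s l)"
      by (subst sum.swap) (simp add: sum_distrib_right)
    also have "\<dots> = (\<Sum>s<n. gr (C $$ (s, i)) * b s l)"
      using that ba by (intro sum.cong) auto
    finally show ?thesis .
  qed
  have bP: "(\<Sum>i<n. b j i * gr ((C ^\<^sub>m m) $$ (i, l))) = (\<Sum>i<n. gr ((C ^\<^sub>m m) $$ (i, j)) * b i l)"
    if "j < n" "l < n" for j l m
    using that
  proof (induction m arbitrary: l)
    case 0
    have "(\<Sum>i<n. b j i * gr ((C ^\<^sub>m 0) $$ (i, l))) = (\<Sum>i<n. if i = l then b j i else 0)"
      using 0 C by (intro sum.cong) auto
    moreover have "(\<Sum>i<n. gr ((C ^\<^sub>m 0) $$ (i, j)) * b i l) = (\<Sum>i<n. if i = j then b i l else 0)"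
      using 0 C by (intro sum.cong) auto
    ultimately show ?case using 0 by (simp add: sum.delta)
  next
    case (Suc m)
    let ?P = "C ^\<^sub>m m"
    have P: "?P \<in> carrier_mat n n" using C by simp
    have "(\<Sum>i<n. b j i * gr ((C ^\<^sub>m Suc m) $$ (i, l))) =
        (\<Sum>i<n. \<Sum>r<n. b j i * gr (?P $$ (i, r)) * gr (C $$ (r, l)))"
      using Suc.prems by (simp add: gr_mat_mult[OF P C] sum_distrib_left mult.assoc del: index_mult_mat)
    also have "\<dots> = (\<Sum>r<n. (\<Sum>i<n. b j i * gr (?P $$ (i, r))) * gr (C $$ (r, l)))"
      by (subst sum.swap) (simp add: sum_distrib_right)
    also have "\<dots> = (\<Sum>r<n. (\<Sum>i<n. gr (?P $$ (i, j)) * b i r) * gr (C $$ (r, l)))"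
      using Suc by simp
    also have "\<dots> = (\<Sum>i<n. gr (?P $$ (i, j)) * (\<Sum>r<n. b i r * gr (C $$ (r, l))))"
      by (simp only: sum_distrib_left sum_distrib_right mult.assoc) (rule sum.swap)
    also have "\<dots> = (\<Sum>i<n. gr (?P $$ (i, j)) * (\<Sum>r<n. gr (C $$ (r, i)) * b r l))"
      using Suc.prems bC by simp
    also have "\<dots> = (\<Sum>r<n. (\<Sum>i<n. gr (C $$ (r, i)) * gr (?P $$ (i, j))) * b r l)"
    proof -
      have *: "gr (C $$ (r, i)) * gr (?P $$ (i, j)) = gr (?P $$ (i, j)) * gr (C $$ (r, i))" for r i
        by (rule gr_commute)
      show ?thesis
        by (simp only: * sum_distrib_left sum_distrib_right mult.assoc) (rule sum.swap)
    qed
    also have "\<dots> = (\<Sum>r<n. gr ((C * ?P) $$ (r, j)) * b r l)"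
      using Suc.prems by (simp add: gr_mat_mult[OF C P] del: index_mult_mat)
    finally show ?case by (simp add: pow_mat_commute[OF C])
  qed
  obtain m where m: "k = Suc m" using k gr0_implies_Suc by blast
  let ?P = "C ^\<^sub>m m" let ?t = "\<Sum>i<n. gr ((C ^\<^sub>m k) $$ (i, i))"
  have P: "?P \<in> carrier_mat n n" using C by simp
  have "?t = (\<Sum>i<n. \<Sum>l<n. \<Sum>j<n. gr (?P $$ (i, l)) * a l j * b j i)"
    by (simp add: m gr_mat_mult[OF P C] grC sum_distrib_left mult.assoc del: index_mult_mat)
  also have "\<dots> = (\<Sum>i<n. \<Sum>l<n. \<Sum>j<n. - (b j i * gr (?P $$ (i, l)) * a l j))"
  proof (intro sum.cong refl)
    fix i l j
    have "gr (?P $$ (i, l)) * a l j * b j i = - (b j i * (gr (?P $$ (i, l)) * a l j))"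
      using a b by (intro godd_anticommute) auto
    then show "gr (?P $$ (i, l)) * a l j * b j i = - (b j i * gr (?P $$ (i, l)) * a l j)"
      by (simp add: mult.assoc)
  qed
  also have "\<dots> = - (\<Sum>l<n. \<Sum>j<n. (\<Sum>i<n. b j i * gr (?P $$ (i, l))) * a l j)"
    by (simp only: sum_negf sum_distrib_right)
       (subst sum.swap, rule arg_cong[of _ _ uminus], rule sum.cong[OF refl], rule sum.swap)
  also have "(\<Sum>l<n. \<Sum>j<n. (\<Sum>i<n. b j i * gr (?P $$ (i, l))) * a l j) =
      (\<Sum>l<n. \<Sum>j<n. (\<Sum>i<n. gr (?P $$ (i, j)) * b i l) * a l j)"
    by (intro sum.cong refl) (simp add: bP)
  also have "\<dots> = (\<Sum>j<n. \<Sum>i<n. gr (?P $$ (i, j)) * (\<Sum>l<n. b i l * a l j))"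
    by (simp only: sum_distrib_left sum_distrib_right mult.assoc)
       (subst sum.swap, rule sum.cong[OF refl], rule sum.swap)
  also have "\<dots> = (\<Sum>i<n. \<Sum>j<n. gr (?P $$ (i, j)) * gr (C $$ (j, i)))"
    by (subst sum.swap) (simp add: ba)
  also have "\<dots> = ?t" by (simp add: m gr_mat_mult[OF P C] del: index_mult_mat)
  finally have "of_nat 2 * ?t = 0" by (simp add: eq_neg_iff_add_eq_0 mult_2)
  then have "?t = 0" by (rule grassmann_torsion_free) simp
  then show ?thesis by (intro gr_eqI) (simp add: C_def)
qed

section \<open>The matrices of the theorem\<close>

text \<open>The indices are shifted to start at 0, as for the type of matrices.\<close>
definition agr :: "nat \<Rightarrow> nat \<Rightarrow> grassmann" where
  "agr i j = (if i < j then ggen (GA (Suc i) (Suc j))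
     else if j < i then - ggen (GA (Suc j) (Suc i)) else 0)"
definition bgr :: "nat \<Rightarrow> nat \<Rightarrow> grassmann" where
  "bgr i j = ggen (GB (Suc (min i j)) (Suc (max i j)))"

lemma gcoeff_agr: "gcoeff (agr i j) = a_entry (Suc i) (Suc j)"
  by (auto simp: agr_def a_entry_def ggen.rep_eq uminus_grassmann.rep_eq zero_grassmann.rep_eq)

lemma gcoeff_bgr: "gcoeff (bgr i j) = b_entry (Suc i) (Suc j)"
  by (simp add: bgr_def b_entry_def ggen.rep_eq)

lemma agr_bgr_odd: "godd (agr i j)" "godd (bgr i j)"
  by (auto simp: agr_def bgr_def)
lemma agr_skew: "agr j i = - agr i j" by (auto simp: agr_def)
lemma bgr_sym: "bgr j i = bgr i j" by (simp add: bgr_def min.commute max.commute)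

text \<open>The generators \<open>GA i j\<close> and \<open>GB i j\<close> with \<open>j = 0\<close> do not occur in the two matrices and serve as
  the fresh generators.\<close>
lemma agr_bgr_avoid:
  "gavoids (range (\<lambda>i. GA (Suc i) 0) \<union> range (\<lambda>i. GB (Suc i) 0)) (agr i j)"
  "gavoids (range (\<lambda>i. GA (Suc i) 0) \<union> range (\<lambda>i. GB (Suc i) 0)) (bgr i j)"
  "gavoids {GA 0 0} (agr i j)" "gavoids {GA 0 0} (bgr i j)"
  by (auto simp: agr_def bgr_def)

lemma odd_mat_prod_pow_mult_eq_0:
  assumes km: "k < n" "m < n"
  shows "(\<Sum>r<n. gr ((odd_mat_prod n agr bgr ^\<^sub>m (n - 1)) $$ (k, r)) * agr r m) = 0"
proof -
  define C where "C = odd_mat_prod n agr bgr"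
  \<comment> \<open>The first index 0 keeps \<eta> out of the two families indexed by
    \<open>Suc i\<close>, so the modified matrix still avoids them.\<close>
  define \<eta> where "\<eta> = GA 0 0"
  have C: "C \<in> carrier_mat n n" by (simp add: C_def)
  have pow: "C ^\<^sub>m (n - 1) = adj_mat (- C)"
    unfolding C_def
    by (rule adj_mat_uminus_eq_pow[symmetric])
       (auto intro!: trace_odd_mat_prod_pow agr_skew bgr_sym agr_bgr_odd intro: even_grassmann_torsion_free)
  define b where "b j l = (if l = k then if j = m then ggen \<eta> else 0 else bgr j l)" for j l
  have b: "godd (b j l)" for j l by (auto simp: b_def agr_bgr_odd)
  \<comment> \<open>The sign is put on A so that D agrees with -C outside column k; its cofactors
    along that column are then those of -C, hence entries of C^(n-1).\<close>
  define D where "D = odd_mat_prod n (\<lambda>i j. - agr i j) b"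
  have D: "D \<in> carrier_mat n n" by (simp add: D_def)
  have "det D = 0"
    unfolding D_def
  proof (rule det_skew_odd_mat_prod[where z = "\<lambda>i. GA (Suc i) 0" and w = "\<lambda>i. GB (Suc i) 0"])
    show "gavoids (range (\<lambda>i. GA (Suc i) 0) \<union> range (\<lambda>i. GB (Suc i) 0)) (b i j)" for i j
      using agr_bgr_avoid(2)[of i j] by (auto simp: b_def \<eta>_def)
    show "- agr j i = - (- agr i j)" for i j using agr_skew[of i j] by simp
  qed (use km b in \<open>auto simp: agr_bgr_odd agr_bgr_avoid inj_def\<close>)
  \<comment> \<open>Laplace expansion along the modified column, whose entries are - a_rm
    \<eta>.\<close>
  then have "(\<Sum>r<n. D $$ (r, k) * cofactor D r k) = 0"
    using laplace_expansion_column[OF D km(1)] by simp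
  moreover have "D $$ (r, k) = (- agr r m) \<star> ggen \<eta>" if "r < n" for r
  proof -
    have "gr (D $$ (r, k)) = (\<Sum>j=0..<n. - agr r j * b j k)"
      using that km b unfolding D_def by (subst gr_odd_mat_prod) (auto simp: agr_bgr_odd)
    also have "\<dots> = (\<Sum>j=0..<n. if j = m then - agr r j * ggen \<eta> else 0)"
      by (rule sum.cong) (auto simp: b_def)
    finally have "gr (D $$ (r, k)) = \<dots>" .
    then show ?thesis using km by (intro gr_eqI) (simp add: agr_bgr_odd sum.delta)
  qed
  moreover have "cofactor D r k = (C ^\<^sub>m (n - 1)) $$ (k, r)" if "r < n" for r
  proof -
    have "D $$ (i, l) = (- C) $$ (i, l)" if "i < n" "l < n" "l \<noteq> k" for i l
      using that by (simp add: D_def C_def odd_mat_prod_def b_def odd_prod_minus_left agr_bgr_odd sum_negf)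
    then have "mat_delete D r k = mat_delete (- C) r k"
      unfolding mat_delete_def using C D by (intro eq_matI) auto
    then have "cofactor D r k = cofactor (- C) r k" by (simp add: cofactor_def)
    then show ?thesis unfolding pow using C that km by (simp add: adj_mat_def)
  qed
  ultimately have "(\<Sum>r<n. ((- agr r m) \<star> ggen \<eta>) * (C ^\<^sub>m (n - 1)) $$ (k, r)) = 0"
    by simp
  then have *: "gr (\<Sum>r<n. ((- agr r m) \<star> ggen \<eta>) * (C ^\<^sub>m (n - 1)) $$ (k, r)) = 0"
    by (simp only: gr_simps)
  then have "(\<Sum>r<n. gr ((C ^\<^sub>m (n - 1)) $$ (k, r)) * agr r m) * ggen \<eta> = 0"
  proof -
    \<comment> \<open>Even factors move to the front, so \<eta> stands last and can be
      cancelled.\<close>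
    have "agr r m * ggen \<eta> * gr c = gr c * agr r m * ggen \<eta>" for r c
      by (simp only: gr_commute mult.assoc)
    with * show ?thesis by (simp add: agr_bgr_odd sum_negf sum_distrib_right)
  qed
  moreover have "gavoids {\<eta>} (\<Sum>r<n. gr ((C ^\<^sub>m (n - 1)) $$ (k, r)) * agr r m)"
  proof -
    have "gavoids {\<eta>} (gr ((C ^\<^sub>m q) $$ (i, l)))" if "i < n" "l < n" for q i l
      using that
    proof (induction q arbitrary: l)
      case 0
      then show ?case using C by auto
    next
      case (Suc q)
      have "gavoids {\<eta>} (gr (C $$ (r, l)))" if "r < n" for r
        using that Suc.prems agr_bgr_avoid by (auto simp: C_def gr_odd_mat_prod agr_bgr_odd \<eta>_def)
      then show ?case using Suc C by (auto simp: scalar_prod_def)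
    qed
    then show ?thesis using km(1) agr_bgr_avoid(3) by (auto simp: \<eta>_def)
  qed
  ultimately show ?thesis unfolding C_def[symmetric] by (rule gavoids_mult_ggen_eq_0)
qed

text \<open>Transfers products from coefficient functions with indices from 1 to ring elements with
  indices from 0.\<close>

lemma mat_mult_gcoeff:
  assumes "\<And>i j. i < n \<Longrightarrow> j < n \<Longrightarrow> M (Suc i) (Suc j) = gcoeff (M' i j)"
    and "\<And>i j. i < n \<Longrightarrow> j < n \<Longrightarrow> N (Suc i) (Suc j) = gcoeff (N' i j)"
    and "i < n" "k < n"
  shows "mat_mult n M N (Suc i) (Suc k) = gcoeff (\<Sum>j<n. M' i j * N' j k)"
proof
  fix S
  have "mat_mult n M N (Suc i) (Suc k) S = (\<Sum>j<n. ext_mult (M (Suc i) (Suc j)) (N (Suc j) (Suc k)) S)"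
    unfolding mat_mult_def by (simp add: sum.atLeast1_atMost_eq)
  then show "mat_mult n M N (Suc i) (Suc k) S = gcoeff (\<Sum>j<n. M' i j * N' j k) S"
    using assms by (simp add: times_grassmann.rep_eq)
qed

theorem theorem5p5:
  fixes n :: nat
  shows "\<forall>i\<in>{1..n}. \<forall>k\<in>{1..n}.
    mat_mult n (mat_pow n (mat_mult n a_entry b_entry) (n - 1)) a_entry i k = ext_zero"
proof (intro ballI)
  fix i k assume ik: "i \<in> {1..n}" "k \<in> {1..n}"
  let ?C = "odd_mat_prod n agr bgr"
  have AB: "mat_mult n a_entry b_entry (Suc i) (Suc j) = gcoeff (gr (?C $$ (i, j)))"
    if "i < n" "j < n" for i j
    using that by (simp add: mat_mult_gcoeff[of n _ agr _ bgr] gcoeff_agr gcoeff_bgr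
        gr_odd_mat_prod agr_bgr_odd atLeast0LessThan del: gcoeff_sum)
  have pow: "mat_pow n (mat_mult n a_entry b_entry) q (Suc i) (Suc j) = gcoeff (gr ((?C ^\<^sub>m q) $$ (i, j)))"
    if "i < n" "j < n" for q i j
    using that
  proof (induction q arbitrary: i j)
    case 0
    then show ?case
      by (auto simp: mat_id_def odd_mat_prod_def one_grassmann.rep_eq zero_grassmann.rep_eq)
  next
    case (Suc q)
    have "mat_pow n (mat_mult n a_entry b_entry) (Suc q) (Suc i) (Suc j) =
        gcoeff (\<Sum>l<n. gr ((?C ^\<^sub>m q) $$ (i, l)) * gr (?C $$ (l, j)))"
      using Suc AB unfolding mat_pow.simps by (intro mat_mult_gcoeff) auto
    also have "(\<Sum>l<n. gr ((?C ^\<^sub>m q) $$ (i, l)) * gr (?C $$ (l, j))) = gr ((?C ^\<^sub>m Suc q) $$ (i, j))"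
      using Suc.prems by (simp add: gr_mat_mult[where n = n] del: index_mult_mat)
    finally show ?case .
  qed
  obtain i' k' where i': "i = Suc i'" "i' < n" and k': "k = Suc k'" "k' < n"
    using ik by (cases i; cases k) auto
  have "mat_mult n (mat_pow n (mat_mult n a_entry b_entry) (n - 1)) a_entry i k =
      gcoeff (\<Sum>r<n. gr ((?C ^\<^sub>m (n - 1)) $$ (i', r)) * agr r k')"
    unfolding i' k' using i' k' pow gcoeff_agr by (intro mat_mult_gcoeff) auto
  also have "\<dots> = ext_zero"
    unfolding odd_mat_prod_pow_mult_eq_0[OF i'(2) k'(2)] by (rule zero_grassmann.rep_eq)
  finally show "mat_mult n (mat_pow n (mat_mult n a_entry b_entry) (n - 1)) a_entry i k = ext_zero" .
qed

end
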